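(* Let $\widetilde T(\mathbf z,\boldsymbol\theta)$ be a test statistic, $B_\alpha(\boldsymbol\theta)$ sets with $\mathbb P\{\widetilde T(G_z(\boldsymbol\theta,\mathbf U),\boldsymbol\theta)\in B_\alpha(\boldsymbol\theta)\}\ge\alpha$ for all $\boldsymbol\theta\in\Theta$, $\widetilde\Gamma_\alpha(\mathbf z)=\{\boldsymbol\theta:\widetilde T(\mathbf z,\boldsymbol\theta)\in B_\alpha(\boldsymbol\theta)\}$, and let $$\Gamma_\alpha(\mathbf z)=\{\boldsymbol\theta:\exists\,\mathbf u^*\in\mathcal U\text{ such that }\mathbf z=G_z(\boldsymbol\theta,\mathbf u^* ),\ \widetilde T(G_z(\boldsymbol\theta,\mathbf u^* ),\boldsymbol\theta)\in B_\alpha(\boldsymbol\theta)\}$$ be the corresponding repro samples confidence set. (a) If $\widetilde T$ corresponds to the uniformly most powerful test and $\widetilde\Gamma_\alpha$ is a level-$\alpha$ uniformly most accurate (UMA) confidence set, then $\Gamma_\alpha$ is also a level-$\alpha$ UMA confidence set. (b) If $\widetilde T$ corresponds to the uniformly most powerful unbiased test and $\widetilde\Gamma_\alpha$ is a level-$\alpha$ UMA unbiased confidence set, then $\Gamma_\alpha$ is also a level-$\alpha$ UMA unbiased confidence set.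
   Context: Data model: $\mathbf Z=G_z(\boldsymbol\theta_0,\mathbf U)$, where $\boldsymbol\theta_0\in\Theta$ is the true parameter, $\mathbf U$ is a random vector in $\mathcal U$ with known distribution, and $G_z:\Theta\times\mathcal U\to\mathcal Z$ is known. A level-$\alpha$ confidence set $C_\alpha$ is a set-valued function of the data with $\mathbb P\{\boldsymbol\theta_0\in C_\alpha(\mathbf Z)\}\ge\alpha$ (for every true value $\boldsymbol\theta_0$). It is unbiased if $\mathbb P\{\boldsymbol\theta'\in C_\alpha(\mathbf Z)\}\le\alpha$ for every $\boldsymbol\theta'\ne\boldsymbol\theta_0$. A level-$\alpha$ confidence set is UMA (respectively UMA unbiased) if it minimizes the probability of false coverage $\mathbb P\{\boldsymbol\theta'\in C_\alpha(\mathbf Z)\}$, $\boldsymbol\theta'\neq\boldsymbol\theta_0$, over the class of all level-$\alpha$ confidence sets (respectively all unbiased level-$\alpha$ confidence sets). *)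

theory Defs
  imports "HOL-Probability.Probability"
begin

text \<open>
  Throughout, \<open>P\<close> is the underlying probability space, \<open>N\<close> the sample space with its
  sigma-algebra, and \<open>X \<theta> \<omega>\<close> the value of the data when \<open>\<theta>\<close> is the true parameter.
\<close>

definition repro_data :: "('t \<Rightarrow> 'u \<Rightarrow> 'z) \<Rightarrow> ('o \<Rightarrow> 'u) \<Rightarrow> 't \<Rightarrow> 'o \<Rightarrow> 'z" where
  "repro_data G U \<theta> \<omega> = G \<theta> (U \<omega>)"

section \<open>Confidence sets\<close>

text \<open>
  A set-valued statistic must make every event \<open>\<theta>' \<in> C Z\<close> measurable; otherwise the library's
  \<open>measure\<close> would assign such an event the junk value 0.
\<close>
definition set_statistic :: "'z measure \<Rightarrow> 't set \<Rightarrow> ('z \<Rightarrow> 't set) \<Rightarrow> bool" where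
  "set_statistic N \<Theta> C \<longleftrightarrow>
     (\<forall>z\<in>space N. C z \<subseteq> \<Theta>) \<and> (\<forall>\<theta>\<in>\<Theta>. {z \<in> space N. \<theta> \<in> C z} \<in> sets N)"

definition coverage ::
    "'o measure \<Rightarrow> ('t \<Rightarrow> 'o \<Rightarrow> 'z) \<Rightarrow> ('z \<Rightarrow> 't set) \<Rightarrow> 't \<Rightarrow> 't \<Rightarrow> real" where
  "coverage P X C \<theta>\<^sub>0 \<theta>' = measure P {\<omega> \<in> space P. \<theta>' \<in> C (X \<theta>\<^sub>0 \<omega>)}"

definition confidence_set ::
    "'o measure \<Rightarrow> 'z measure \<Rightarrow> 't set \<Rightarrow> ('t \<Rightarrow> 'o \<Rightarrow> 'z) \<Rightarrow> real \<Rightarrow> ('z \<Rightarrow> 't set) \<Rightarrow> bool" where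
  "confidence_set P N \<Theta> X \<alpha> C \<longleftrightarrow>
     set_statistic N \<Theta> C \<and> (\<forall>\<theta>\<^sub>0\<in>\<Theta>. coverage P X C \<theta>\<^sub>0 \<theta>\<^sub>0 \<ge> \<alpha>)"

definition unbiased_confidence_set ::
    "'o measure \<Rightarrow> 'z measure \<Rightarrow> 't set \<Rightarrow> ('t \<Rightarrow> 'o \<Rightarrow> 'z) \<Rightarrow> real \<Rightarrow> ('z \<Rightarrow> 't set) \<Rightarrow> bool" where
  "unbiased_confidence_set P N \<Theta> X \<alpha> C \<longleftrightarrow>
     confidence_set P N \<Theta> X \<alpha> C \<and>
     (\<forall>\<theta>\<^sub>0\<in>\<Theta>. \<forall>\<theta>'\<in>\<Theta>. \<theta>' \<noteq> \<theta>\<^sub>0 \<longrightarrow> coverage P X C \<theta>\<^sub>0 \<theta>' \<le> \<alpha>)"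

definition UMA ::
    "'o measure \<Rightarrow> 'z measure \<Rightarrow> 't set \<Rightarrow> ('t \<Rightarrow> 'o \<Rightarrow> 'z) \<Rightarrow> real \<Rightarrow> ('z \<Rightarrow> 't set) \<Rightarrow> bool" where
  "UMA P N \<Theta> X \<alpha> C \<longleftrightarrow>
     confidence_set P N \<Theta> X \<alpha> C \<and>
     (\<forall>D. confidence_set P N \<Theta> X \<alpha> D \<longrightarrow>
        (\<forall>\<theta>\<^sub>0\<in>\<Theta>. \<forall>\<theta>'\<in>\<Theta>. \<theta>' \<noteq> \<theta>\<^sub>0 \<longrightarrow> coverage P X C \<theta>\<^sub>0 \<theta>' \<le> coverage P X D \<theta>\<^sub>0 \<theta>'))"

definition UMA_unbiased ::
    "'o measure \<Rightarrow> 'z measure \<Rightarrow> 't set \<Rightarrow> ('t \<Rightarrow> 'o \<Rightarrow> 'z) \<Rightarrow> real \<Rightarrow> ('z \<Rightarrow> 't set) \<Rightarrow> bool" where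
  "UMA_unbiased P N \<Theta> X \<alpha> C \<longleftrightarrow>
     unbiased_confidence_set P N \<Theta> X \<alpha> C \<and>
     (\<forall>D. unbiased_confidence_set P N \<Theta> X \<alpha> D \<longrightarrow>
        (\<forall>\<theta>\<^sub>0\<in>\<Theta>. \<forall>\<theta>'\<in>\<Theta>. \<theta>' \<noteq> \<theta>\<^sub>0 \<longrightarrow> coverage P X C \<theta>\<^sub>0 \<theta>' \<le> coverage P X D \<theta>\<^sub>0 \<theta>'))"

section \<open>Tests of a simple null hypothesis\<close>

text \<open>
  A non-randomized test of the null hypothesis \<open>\<theta> = \<theta>\<^sub>1\<close> against the alternative \<open>\<theta> \<noteq> \<theta>\<^sub>1\<close>
  is identified with its rejection region \<open>R\<close>. The parameter \<open>\<beta>\<close> is the bound on the probability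
  of a type I error, so a confidence set of level \<open>\<alpha>\<close> corresponds to \<open>\<beta> = 1 - \<alpha>\<close>.
\<close>

definition rejection_prob :: "'o measure \<Rightarrow> ('t \<Rightarrow> 'o \<Rightarrow> 'z) \<Rightarrow> 'z set \<Rightarrow> 't \<Rightarrow> real" where
  "rejection_prob P X R \<theta> = measure P {\<omega> \<in> space P. X \<theta> \<omega> \<in> R}"

definition level_test ::
    "'o measure \<Rightarrow> 'z measure \<Rightarrow> ('t \<Rightarrow> 'o \<Rightarrow> 'z) \<Rightarrow> real \<Rightarrow> 't \<Rightarrow> 'z set \<Rightarrow> bool" where
  "level_test P N X \<beta> \<theta>\<^sub>1 R \<longleftrightarrow> R \<in> sets N \<and> rejection_prob P X R \<theta>\<^sub>1 \<le> \<beta>"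

definition unbiased_test ::
    "'o measure \<Rightarrow> 'z measure \<Rightarrow> 't set \<Rightarrow> ('t \<Rightarrow> 'o \<Rightarrow> 'z) \<Rightarrow> real \<Rightarrow> 't \<Rightarrow> 'z set \<Rightarrow> bool" where
  "unbiased_test P N \<Theta> X \<beta> \<theta>\<^sub>1 R \<longleftrightarrow>
     level_test P N X \<beta> \<theta>\<^sub>1 R \<and> (\<forall>\<theta>\<in>\<Theta>. \<theta> \<noteq> \<theta>\<^sub>1 \<longrightarrow> rejection_prob P X R \<theta> \<ge> \<beta>)"

definition UMP_test ::
    "'o measure \<Rightarrow> 'z measure \<Rightarrow> 't set \<Rightarrow> ('t \<Rightarrow> 'o \<Rightarrow> 'z) \<Rightarrow> real \<Rightarrow> 't \<Rightarrow> 'z set \<Rightarrow> bool" where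
  "UMP_test P N \<Theta> X \<beta> \<theta>\<^sub>1 R \<longleftrightarrow>
     level_test P N X \<beta> \<theta>\<^sub>1 R \<and>
     (\<forall>S. level_test P N X \<beta> \<theta>\<^sub>1 S \<longrightarrow>
        (\<forall>\<theta>\<in>\<Theta>. \<theta> \<noteq> \<theta>\<^sub>1 \<longrightarrow> rejection_prob P X S \<theta> \<le> rejection_prob P X R \<theta>))"

definition UMP_unbiased_test ::
    "'o measure \<Rightarrow> 'z measure \<Rightarrow> 't set \<Rightarrow> ('t \<Rightarrow> 'o \<Rightarrow> 'z) \<Rightarrow> real \<Rightarrow> 't \<Rightarrow> 'z set \<Rightarrow> bool" where
  "UMP_unbiased_test P N \<Theta> X \<beta> \<theta>\<^sub>1 R \<longleftrightarrow>
     unbiased_test P N \<Theta> X \<beta> \<theta>\<^sub>1 R \<and>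
     (\<forall>S. unbiased_test P N \<Theta> X \<beta> \<theta>\<^sub>1 S \<longrightarrow>
        (\<forall>\<theta>\<in>\<Theta>. \<theta> \<noteq> \<theta>\<^sub>1 \<longrightarrow> rejection_prob P X S \<theta> \<le> rejection_prob P X R \<theta>))"

definition rejection_region ::
    "'z measure \<Rightarrow> ('z \<Rightarrow> 't \<Rightarrow> 's) \<Rightarrow> ('t \<Rightarrow> 's set) \<Rightarrow> 't \<Rightarrow> 'z set" where
  "rejection_region N T B \<theta>\<^sub>1 = {z \<in> space N. T z \<theta>\<^sub>1 \<notin> B \<theta>\<^sub>1}"

section \<open>Confidence sets obtained from a test statistic\<close>

definition test_set :: "'t set \<Rightarrow> ('z \<Rightarrow> 't \<Rightarrow> 's) \<Rightarrow> ('t \<Rightarrow> 's set) \<Rightarrow> 'z \<Rightarrow> 't set" where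
  "test_set \<Theta> T B z = {\<theta> \<in> \<Theta>. T z \<theta> \<in> B \<theta>}"

definition repro_set ::
    "'t set \<Rightarrow> 'u set \<Rightarrow> ('t \<Rightarrow> 'u \<Rightarrow> 'z) \<Rightarrow> ('z \<Rightarrow> 't \<Rightarrow> 's) \<Rightarrow> ('t \<Rightarrow> 's set) \<Rightarrow> 'z \<Rightarrow> 't set" where
  "repro_set \<Theta> V G T B z =
     {\<theta> \<in> \<Theta>. \<exists>u\<in>V. z = G \<theta> u \<and> T (G \<theta> u) \<theta> \<in> B \<theta>}"

end

theory Submission
  imports Defs
begin

text \<open>
  The repro set is contained in the test set, so it covers false values no more often. It covers
  the true value equally often, because the realised \<open>U \<omega>\<close> is itself an admissible witness
  \<open>u\<^sup>*\<close>. Level, unbiasedness and optimality therefore pass from the test set to the repro set.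
\<close>

lemma repro_set_subset_test_set: "repro_set \<Theta> V G T B z \<subseteq> test_set \<Theta> T B z"
  by (auto simp: repro_set_def test_set_def)

text \<open>Measurability puts \<open>U \<omega>\<close> in \<open>space M\<close>, so the two
  membership conditions agree at every outcome, not merely almost surely. At a false value
  \<open>\<theta>'\<close> equality can fail, since the data need not lie in the range of
  \<open>G \<theta>'\<close>.\<close>

lemma coverage_repro_set_true_value:
  assumes "U \<in> measurable P M"
  shows "coverage P (repro_data G U) (repro_set \<Theta> (space M) G T B) \<theta> \<theta> =
         coverage P (repro_data G U) (test_set \<Theta> T B) \<theta> \<theta>"
proof -
  have "\<theta> \<in> repro_set \<Theta> (space M) G T B (repro_data G U \<theta> \<omega>) \<longleftrightarrow>
        \<theta> \<in> test_set \<Theta> T B (repro_data G U \<theta> \<omega>)" if "\<omega> \<in> space P" for \<omega>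
    using measurable_space[OF assms that]
    by (auto simp: repro_set_def test_set_def repro_data_def)
  then show ?thesis
    unfolding coverage_def by (intro arg_cong[where f = "measure P"]) auto
qed

text \<open>This is monotonicity of the measure, which rests on measurability of the larger event; a
  smaller event outside the sigma-algebra would have the default measure 0.\<close>

lemma coverage_mono:
  assumes "finite_measure P" and "X \<theta>\<^sub>0 \<in> measurable P N"
    and "set_statistic N \<Theta> D" and "\<theta>' \<in> \<Theta>" and "\<And>z. C z \<subseteq> D z"
  shows "coverage P X C \<theta>\<^sub>0 \<theta>' \<le> coverage P X D \<theta>\<^sub>0 \<theta>'"
proof -
  have "{z \<in> space N. \<theta>' \<in> D z} \<in> sets N"
    using assms(3,4) by (simp add: set_statistic_def)
  with assms(2) have "X \<theta>\<^sub>0 -` {z \<in> space N. \<theta>' \<in> D z} \<inter> space P \<in> sets P"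
    by (rule measurable_sets)
  \<comment> \<open>The restriction to \<open>space N\<close> is automatic, because
    \<open>X \<theta>\<^sub>0\<close> maps \<open>space P\<close> into it.\<close>
  also have "X \<theta>\<^sub>0 -` {z \<in> space N. \<theta>' \<in> D z} \<inter> space P = {\<omega> \<in> space P. \<theta>' \<in> D (X \<theta>\<^sub>0 \<omega>)}"
    using measurable_space[OF assms(2)] by auto
  finally show ?thesis
    unfolding coverage_def using assms(5)
    by (intro finite_measure.finite_measure_mono[OF assms(1)]) auto
qed

text \<open>Measurability of \<open>C\<close> is assumed separately: it does not pass from a set to
  a smaller one, and the range of \<open>G \<theta>\<close>, which enters the repro set, need not be
  measurable.\<close>

lemma confidence_set_transfer:
  assumes "confidence_set P N \<Theta> X \<alpha> D" and "set_statistic N \<Theta> C"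
    and "\<And>\<theta>. \<theta> \<in> \<Theta> \<Longrightarrow> coverage P X C \<theta> \<theta> = coverage P X D \<theta> \<theta>"
  shows "confidence_set P N \<Theta> X \<alpha> C"
  using assms by (simp add: confidence_set_def)

text \<open>The class of competitors is the same for \<open>C\<close> and \<open>D\<close>, so the
  false coverage of \<open>C\<close> is at most that of \<open>D\<close>, which is at most that of
  any competitor.\<close>

lemma UMA_transfer:
  assumes "UMA P N \<Theta> X \<alpha> D" and "set_statistic N \<Theta> C"
    and "\<And>\<theta>. \<theta> \<in> \<Theta> \<Longrightarrow> coverage P X C \<theta> \<theta> = coverage P X D \<theta> \<theta>"
    and "\<And>\<theta>\<^sub>0 \<theta>'. \<theta>\<^sub>0 \<in> \<Theta> \<Longrightarrow> \<theta>' \<in> \<Theta> \<Longrightarrow> coverage P X C \<theta>\<^sub>0 \<theta>' \<le> coverage P X D \<theta>\<^sub>0 \<theta>'"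
  shows "UMA P N \<Theta> X \<alpha> C"
  using assms(1) confidence_set_transfer[OF _ assms(2,3)] assms(4)
  unfolding UMA_def by (meson order_trans)

text \<open>Unbiasedness is an upper bound on false coverage, so it survives when false coverage
  decreases; this admits \<open>C\<close> to the restricted class, where the chain of inequalities
  through \<open>D\<close> applies again.\<close>

lemma UMA_unbiased_transfer:
  assumes "UMA_unbiased P N \<Theta> X \<alpha> D" and "set_statistic N \<Theta> C"
    and "\<And>\<theta>. \<theta> \<in> \<Theta> \<Longrightarrow> coverage P X C \<theta> \<theta> = coverage P X D \<theta> \<theta>"
    and "\<And>\<theta>\<^sub>0 \<theta>'. \<theta>\<^sub>0 \<in> \<Theta> \<Longrightarrow> \<theta>' \<in> \<Theta> \<Longrightarrow> coverage P X C \<theta>\<^sub>0 \<theta>' \<le> coverage P X D \<theta>\<^sub>0 \<theta>'"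
  shows "UMA_unbiased P N \<Theta> X \<alpha> C"
  using assms(1) confidence_set_transfer[OF _ assms(2,3)] assms(4)
  unfolding UMA_unbiased_def unbiased_confidence_set_def by (meson order_trans)

theorem corollary2:
  fixes P :: "'o measure" and M :: "'u measure" and N :: "'z measure"
    and \<Theta> :: "'t set" and U :: "'o \<Rightarrow> 'u" and G :: "'t \<Rightarrow> 'u \<Rightarrow> 'z"
    and T :: "'z \<Rightarrow> 't \<Rightarrow> 's" and B :: "'t \<Rightarrow> 's set" and \<alpha> :: real
  assumes "prob_space P"
    and "U \<in> measurable P M"
    and "\<And>\<theta>. \<theta> \<in> \<Theta> \<Longrightarrow> G \<theta> \<in> measurable M N"
    and "\<And>\<theta>. \<theta> \<in> \<Theta> \<Longrightarrow> measure P {\<omega> \<in> space P. T (G \<theta> (U \<omega>)) \<theta> \<in> B \<theta>} \<ge> \<alpha>"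
    and "set_statistic N \<Theta> (repro_set \<Theta> (space M) G T B)"
  shows "((\<forall>\<theta>\<^sub>1\<in>\<Theta>. UMP_test P N \<Theta> (repro_data G U) (1 - \<alpha>) \<theta>\<^sub>1 (rejection_region N T B \<theta>\<^sub>1)) \<and>
          UMA P N \<Theta> (repro_data G U) \<alpha> (test_set \<Theta> T B)
            \<longrightarrow> UMA P N \<Theta> (repro_data G U) \<alpha> (repro_set \<Theta> (space M) G T B)) \<and>
         ((\<forall>\<theta>\<^sub>1\<in>\<Theta>. UMP_unbiased_test P N \<Theta> (repro_data G U) (1 - \<alpha>) \<theta>\<^sub>1 (rejection_region N T B \<theta>\<^sub>1)) \<and>
          UMA_unbiased P N \<Theta> (repro_data G U) \<alpha> (test_set \<Theta> T B)
            \<longrightarrow> UMA_unbiased P N \<Theta> (repro_data G U) \<alpha> (repro_set \<Theta> (space M) G T B))"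
proof -
  let ?X = "repro_data G U" and ?C = "repro_set \<Theta> (space M) G T B" and ?D = "test_set \<Theta> T B"
  have X: "?X \<theta> \<in> measurable P N" if "\<theta> \<in> \<Theta>" for \<theta>
    using measurable_compose[OF assms(2) assms(3)[OF that]]
    by (simp add: repro_data_def[abs_def])
  have true_value: "coverage P ?X ?C \<theta> \<theta> = coverage P ?X ?D \<theta> \<theta>" for \<theta>
    by (rule coverage_repro_set_true_value[OF assms(2)])
  \<comment> \<open>Measurability of the test set stays a premise here, because each of the two
    cases below obtains it from its own optimality assumption.\<close>
  have le: "coverage P ?X ?C \<theta>\<^sub>0 \<theta>' \<le> coverage P ?X ?D \<theta>\<^sub>0 \<theta>'"
    if "set_statistic N \<Theta> ?D" "\<theta>\<^sub>0 \<in> \<Theta>" "\<theta>' \<in> \<Theta>" for \<theta>\<^sub>0 \<theta>'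
    using prob_space.finite_measure[OF assms(1)] X[OF that(2)] that(1,3) repro_set_subset_test_set
    by (rule coverage_mono)
  have "UMA P N \<Theta> ?X \<alpha> ?C" if D: "UMA P N \<Theta> ?X \<alpha> ?D"
  proof -
    from D have "set_statistic N \<Theta> ?D"
      by (simp add: UMA_def confidence_set_def)
    then show ?thesis
      by (intro UMA_transfer[OF D assms(5)] true_value le)
  qed
  moreover have "UMA_unbiased P N \<Theta> ?X \<alpha> ?C" if D: "UMA_unbiased P N \<Theta> ?X \<alpha> ?D"
  proof -
    from D have "set_statistic N \<Theta> ?D"
      by (simp add: UMA_unbiased_def unbiased_confidence_set_def confidence_set_def)
    then show ?thesis
      by (intro UMA_unbiased_transfer[OF D assms(5)] true_value le)
  qed
  ultimately show ?thesis
    by blast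
qed

end
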